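(* Let $\mathsf{A}\subset GL_2(\mathbb{R})$ with $\mathscr{R}(\mathsf{A})\neq\emptyset$ be such that $\mathcal{S}(\mathsf{A})$ is almost multiplicative. Let $X_u=\{A\mathbb{R}^2 : A\in\mathscr{R}(\mathsf{A})\}$ and $X_s=\{\ker A : A\in\mathscr{R}(\mathsf{A})\}$. Then $X_u=\overline{\{u(A): A\in\mathcal{S}(\mathsf{A})\text{ is proximal}\}}$ and $X_s=\overline{\{s(A): A\in\mathcal{S}(\mathsf{A})\text{ is proximal}\}}$.
   Context: $\|\cdot\|$ is the operator norm; closures are in the real projective line $\mathbb{RP}^1$. $\mathcal{S}(\mathsf{A})$ is the semigroup of finite products of elements of $\mathsf{A}$; $\mathscr{S}(\mathsf{A})=\overline{\mathbb{R}\mathcal{S}(\mathsf{A})}\subset M_2(\mathbb{R})$; $\mathscr{R}(\mathsf{A})=\{A\in\mathscr{S}(\mathsf{A}):\operatorname{rank}(A)=1\}$. A semigroup $\mathcal{S}$ is almost multiplicative if there is $\kappa>0$ with $\|AB\|\ge\kappa\|A\|\|B\|$ for all $A,B\in\mathcal{S}$. A matrix is proximal if it has two real eigenvalues with distinct absolute values; $u(A)$ and $s(A)$ are the eigenspaces of the eigenvalues of larger and smaller absolute value. *)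

theory Defs
  imports "HOL-Analysis.Analysis"
begin

type_synonym mat2 = "real^2^2"

text \<open>Operator norm of a 2x2 real matrix (w.r.t. the Euclidean norm on real^2).\<close>
definition opnorm :: "mat2 \<Rightarrow> real" where
  "opnorm M = onorm (\<lambda>x. M *v x)"

text \<open>The semigroup of finite (nonempty) products of elements of a set.\<close>
inductive_set semigroup_gen :: "mat2 set \<Rightarrow> mat2 set" for S :: "mat2 set" where
  base: "M \<in> S \<Longrightarrow> M \<in> semigroup_gen S"
| step: "M \<in> semigroup_gen S \<Longrightarrow> N \<in> S \<Longrightarrow> M ** N \<in> semigroup_gen S"

text \<open>closure of R * S(A) in M_2(R)\<close>
definition scrS :: "mat2 set \<Rightarrow> mat2 set" where
  "scrS S = closure {c *\<^sub>R M | c M. M \<in> semigroup_gen S}"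

definition scrR :: "mat2 set \<Rightarrow> mat2 set" where
  "scrR S = {M \<in> scrS S. rank M = 1}"

definition almost_multiplicative :: "mat2 set \<Rightarrow> bool" where
  "almost_multiplicative T \<longleftrightarrow>
     (\<exists>\<kappa>>0. \<forall>A\<in>T. \<forall>B\<in>T. opnorm (A ** B) \<ge> \<kappa> * opnorm A * opnorm B)"

definition is_real_eig :: "mat2 \<Rightarrow> real \<Rightarrow> bool" where
  "is_real_eig M l \<longleftrightarrow> (\<exists>v. v \<noteq> 0 \<and> M *v v = l *\<^sub>R v)"

definition proximal :: "mat2 \<Rightarrow> bool" where
  "proximal M \<longleftrightarrow> (\<exists>l1 l2. is_real_eig M l1 \<and> is_real_eig M l2 \<and> \<bar>l1\<bar> \<noteq> \<bar>l2\<bar>)"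

definition eig_large :: "mat2 \<Rightarrow> real" where
  "eig_large M = (THE l. is_real_eig M l \<and> (\<exists>m. is_real_eig M m \<and> \<bar>m\<bar> < \<bar>l\<bar>))"

definition eig_small :: "mat2 \<Rightarrow> real" where
  "eig_small M = (THE l. is_real_eig M l \<and> (\<exists>m. is_real_eig M m \<and> \<bar>l\<bar> < \<bar>m\<bar>))"

text \<open>u(A), s(A): eigenspaces of the eigenvalues of larger / smaller absolute value.\<close>
definition u_space :: "mat2 \<Rightarrow> (real^2) set" where
  "u_space M = {v. M *v v = eig_large M *\<^sub>R v}"

definition s_space :: "mat2 \<Rightarrow> (real^2) set" where
  "s_space M = {v. M *v v = eig_small M *\<^sub>R v}"

text \<open>RP^1 = lines through 0 in real^2; topologised via the embedding
  L = span{v}, |v| = 1  \<mapsto>  v v^T (orthogonal projection onto L).\<close>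
definition is_line :: "(real^2) set \<Rightarrow> bool" where
  "is_line L \<longleftrightarrow> subspace L \<and> dim L = 1"

definition line_proj :: "(real^2) set \<Rightarrow> mat2" where
  "line_proj L = (let v = (SOME v. v \<in> L \<and> norm v = 1) in \<chi> i j. v$i * v$j)"

definition rp1_closure :: "(real^2) set set \<Rightarrow> (real^2) set set" where
  "rp1_closure X = {L. is_line L \<and> line_proj L \<in> closure (line_proj ` X)}"

end

theory Submission
  imports Defs
begin

(* If M in S(A) is proximal with eigenvalues |a| > |b|, the normalised powers M^n / a^n converge
   to the rank one projection onto u(M) along s(M), so u(M) and s(M) are image and kernel of an
   element of scrR(A).  Conversely, almost multiplicativity survives in the limit strongly enough
   to exclude nonzero nilpotents, so every R in scrR(A) has nonzero trace.  Approximating R by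
   scaled products N_n, the eigenvalues of N_n tend to trace R and 0; hence N_n is eventually
   proximal, with u(N_n) tending to the image and s(N_n) to the kernel of R.  Finally, image and
   kernel depend continuously on R in the compact set of rank one elements of norm one, so the
   sets X_u and X_s are closed in RP^1. *)

definition orth_proj :: "real^2 \<Rightarrow> mat2" where
  "orth_proj v = (\<chi> i j. v$i * v$j / (norm v)\<^sup>2)"

lemma orth_proj_apply: "orth_proj v *v x = ((v \<bullet> x) / (norm v)\<^sup>2) *\<^sub>R v"
  by (simp add: orth_proj_def vec_eq_iff matrix_vector_mult_def inner_vec_def sum_2
      add_divide_distrib algebra_simps)

lemma line_proj_span:
  fixes v :: "real^2"
  assumes "v \<noteq> 0"
  shows "line_proj (span {v}) = orth_proj v"
proof -
  define w where "w = (SOME w. w \<in> span {v} \<and> norm w = 1)"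
  have "\<exists>w. w \<in> span {v} \<and> norm w = 1"
    using assms by (intro exI[of _ "(1 / norm v) *\<^sub>R v"]) (auto simp: span_base span_scale)
  then have w: "w \<in> span {v}" "norm w = 1"
    unfolding w_def by (metis (mono_tags, lifting) someI_ex)+
  then obtain k where k: "w = k *\<^sub>R v" by (auto simp: span_singleton)
  with w(2) have "\<bar>k\<bar> * norm v = 1" by simp
  then have "(\<bar>k\<bar> * norm v)\<^sup>2 = 1" by simp
  then have kk: "k * k = 1 / (norm v)\<^sup>2"
    using assms by (simp add: power_mult_distrib field_simps power2_eq_square)
  have "k * v $ i * k * v $ j = v $ i * v $ j / (norm v)\<^sup>2" for i j
  proof -
    have "k * v $ i * k * v $ j = (k * k) * (v $ i * v $ j)" by (simp only: mult_ac)
    then show ?thesis by (simp add: kk)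
  qed
  then show ?thesis
    unfolding line_proj_def orth_proj_def Let_def w_def[symmetric]
    by (simp add: vec_eq_iff k mult.assoc[symmetric])
qed

lemma is_line_span: "v \<noteq> 0 \<Longrightarrow> is_line (span {v :: real^2})"
  by (simp add: is_line_def dim_span)

lemma is_lineE:
  fixes L :: "(real^2) set"
  assumes "is_line L"
  obtains v where "v \<noteq> 0" "L = span {v}"
proof -
  from assms have L: "subspace L" "dim L = 1" by (auto simp: is_line_def)
  obtain B where B: "B \<subseteq> L" "independent B" "L \<subseteq> span B" "card B = dim L"
    using basis_exists by blast
  then obtain v where "B = {v}" using L(2) by (auto simp: card_Suc_eq)
  with B L(1) have "v \<noteq> 0" "L = span {v}"
    by (auto dest: dependent_zero simp: span_minimal subset_antisym)
  then show thesis by (rule that)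
qed

lemma line_proj_inj:
  assumes "is_line L" "is_line L'" "line_proj L = line_proj L'"
  shows "L = L'"
proof -
  obtain v where v: "v \<noteq> 0" "L = span {v}" using assms(1) by (rule is_lineE)
  obtain w where w: "w \<noteq> 0" "L' = span {w}" using assms(2) by (rule is_lineE)
  have proj_eq: "orth_proj v = orth_proj w"
    using assms(3) v w by (simp add: line_proj_span)
  have span_mem: "u \<in> span {u'}" if "u \<noteq> 0" "orth_proj u = orth_proj u'" for u u' :: "real^2"
  proof -
    have "u = orth_proj u' *v u"
      using that by (simp flip: that(2) add: orth_proj_apply dot_square_norm)
    then show ?thesis by (metis orth_proj_apply span_base span_scale singletonI)
  qed
  have "span {v} = span {w}"
    using span_mem[OF v(1) proj_eq] span_mem[OF w(1) proj_eq[symmetric]]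
    by (simp add: span_minimal subset_antisym)
  then show ?thesis using v(2) w(2) by simp
qed

lemma tendsto_orth_proj:
  assumes "(f \<longlongrightarrow> v) F" "v \<noteq> 0"
  shows "((\<lambda>x. orth_proj (f x)) \<longlongrightarrow> orth_proj v) F"
  unfolding orth_proj_def using assms
  by (intro tendsto_vec_lambda tendsto_divide tendsto_mult tendsto_vec_nth tendsto_power
      tendsto_norm) auto

definition trace2 :: "mat2 \<Rightarrow> real" where
  "trace2 M = M$1$1 + M$2$2"

lemma mat2_square: "M ** M = trace2 M *\<^sub>R M - det M *\<^sub>R mat 1"
  by (simp add: vec_eq_iff forall_2 matrix_matrix_mult_def sum_2 trace2_def det_2 mat_def
      algebra_simps)

lemma det_minus_scalar: "det (M - l *\<^sub>R mat 1) = l\<^sup>2 - trace2 M * l + det M"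
  by (simp add: det_2 trace2_def mat_def power2_eq_square algebra_simps)

lemma matrix_minus_scalar_apply: "(M - l *\<^sub>R mat 1) *v x = M *v x - l *\<^sub>R x"
  for M :: "real^'n^'n"
  by (simp add: matrix_vector_mult_diff_rdistrib flip: scaleR_matrix_vector_assoc)

lemma det_eq_0_imp_kernel: "det (M :: mat2) = 0 \<Longrightarrow> \<exists>v. v \<noteq> 0 \<and> M *v v = 0"
  using matrix_nonfull_linear_equations_eq[of M] det_eq_0_rank[of M] by auto

lemma is_real_eig_iff: "is_real_eig M l \<longleftrightarrow> l\<^sup>2 - trace2 M * l + det M = 0"
proof
  assume "is_real_eig M l"
  then obtain v where v: "v \<noteq> 0" "M *v v = l *\<^sub>R v" by (auto simp: is_real_eig_def)
  have "(l\<^sup>2) *\<^sub>R v = (M ** M) *v v"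
    by (simp add: matrix_vector_mul_assoc[symmetric] v matrix_vector_mult_scaleR power2_eq_square)
  also have "\<dots> = (trace2 M * l - det M) *\<^sub>R v"
    by (simp add: mat2_square matrix_vector_mult_diff_rdistrib v scaleR_diff_left
        scaleR_matrix_vector_assoc[symmetric])
  finally have "(l\<^sup>2 - trace2 M * l + det M) *\<^sub>R v = 0" by (simp add: algebra_simps)
  then show "l\<^sup>2 - trace2 M * l + det M = 0" using v by simp
next
  assume "l\<^sup>2 - trace2 M * l + det M = 0"
  then obtain v where "v \<noteq> 0" "(M - l *\<^sub>R mat 1) *v v = 0"
    using det_eq_0_imp_kernel det_minus_scalar by metis
  then show "is_real_eig M l"
    unfolding is_real_eig_def by (intro exI[of _ v]) (simp add: matrix_minus_scalar_apply)
qed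

lemma rank_mat2_eq_1_iff: "rank (M :: mat2) = 1 \<longleftrightarrow> M \<noteq> 0 \<and> det M = 0"
  using rank_eq_0[of M] det_eq_0_rank[of M] rank_bound[of M] by auto

lemma range_rank1_eq_span_column:
  fixes M :: mat2
  assumes "M \<noteq> 0" "det M = 0" "column j M \<noteq> 0"
  shows "range ((*v) M) = span {column j M}"
proof -
  have "column j M \<in> range ((*v) M)"
    by (metis matrix_vector_mult_basis rangeI)
  moreover have "dim (range ((*v) M)) = 1"
    using assms rank_mat2_eq_1_iff by (simp flip: rank_dim_range)
  ultimately have "span {column j M} = span (range ((*v) M))"
    using assms(3) by (intro dim_eq_span) auto
  moreover have "subspace (range ((*v) M))"
    by (simp add: subspace_UNIV linear_subspace_image)
  ultimately show ?thesis by (metis span_eq_iff)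
qed

lemma range_scaleR_matrix:
  fixes Q :: "real^'n^'m"
  assumes "c \<noteq> 0"
  shows "range ((*v) (c *\<^sub>R Q)) = range ((*v) Q)"
proof -
  have "Q *v y = (c *\<^sub>R Q) *v ((1 / c) *\<^sub>R y)" "(c *\<^sub>R Q) *v y = Q *v (c *\<^sub>R y)" for y
    using assms by (simp_all add: matrix_vector_mult_scaleR flip: scaleR_matrix_vector_assoc)
  then show ?thesis by (intro subset_antisym image_subsetI) (metis rangeI)+
qed

lemma obtain_column_nonzero:
  assumes "(M :: mat2) \<noteq> 0"
  obtains j where "column j M \<noteq> 0"
  using assms by (auto simp: column_def vec_eq_iff)

lemma is_line_range_rank1:
  fixes M :: mat2
  assumes "M \<noteq> 0" "det M = 0"
  shows "is_line (range ((*v) M))"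
  using assms range_rank1_eq_span_column is_line_span by (metis obtain_column_nonzero)

text \<open>On rank one matrices the image line depends continuously on the matrix, because
  near a nonzero column the image is spanned by that column.\<close>
lemma tendsto_line_proj_range:
  fixes Q :: "'a \<Rightarrow> mat2"
  assumes "(Q \<longlongrightarrow> Q0) F" "Q0 \<noteq> 0" "det Q0 = 0" "eventually (\<lambda>x. det (Q x) = 0) F"
  shows "((\<lambda>x. line_proj (range ((*v) (Q x)))) \<longlongrightarrow> line_proj (range ((*v) Q0))) F"
proof -
  obtain j where j: "column j Q0 \<noteq> 0" using assms(2) by (rule obtain_column_nonzero)
  have col: "((\<lambda>x. column j (Q x)) \<longlongrightarrow> column j Q0) F"
    unfolding column_def using assms(1) by (intro tendsto_vec_lambda tendsto_vec_nth)
  have "eventually (\<lambda>x. column j (Q x) \<noteq> 0) F"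
    by (rule tendsto_imp_eventually_ne[OF col j])
  then have "eventually (\<lambda>x. orth_proj (column j (Q x)) = line_proj (range ((*v) (Q x)))) F"
    using assms(4)
  proof eventually_elim
    case (elim x)
    then have "Q x \<noteq> 0" by (auto simp: column_def vec_eq_iff)
    with elim show ?case by (simp add: range_rank1_eq_span_column line_proj_span)
  qed
  moreover have "orth_proj (column j Q0) = line_proj (range ((*v) Q0))"
    using range_rank1_eq_span_column[OF assms(2,3) j] line_proj_span j by simp
  ultimately show ?thesis
    using tendsto_orth_proj[OF col j] by (simp add: tendsto_cong)
qed

lemma adjugate_rank1:
  fixes R :: mat2
  assumes "R \<noteq> 0" "det R = 0"
  shows "R - trace2 R *\<^sub>R mat 1 \<noteq> 0" "det (R - trace2 R *\<^sub>R mat 1) = 0"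
proof
  assume "R - trace2 R *\<^sub>R mat 1 = 0"
  then have R: "R = trace2 R *\<^sub>R mat 1" by simp
  then have "trace2 R = trace2 (trace2 R *\<^sub>R mat 1)" by (rule arg_cong)
  then have "trace2 R = 0" by (simp add: trace2_def mat_def)
  with R assms(1) show False by simp
next
  show "det (R - trace2 R *\<^sub>R mat 1) = 0"
    using assms(2) by (simp add: det_minus_scalar power2_eq_square)
qed

text \<open>\<open>trace2 R *\<^sub>R mat 1 - R\<close> is the adjugate of \<open>R\<close>: its image lies in the kernel of a singular
  \<open>R\<close>, and both are lines.\<close>
lemma kernel_rank1_eq_range:
  fixes R :: mat2
  assumes "R \<noteq> 0" "det R = 0"
  shows "{x. R *v x = 0} = range ((*v) (R - trace2 R *\<^sub>R mat 1))"
proof (rule subspace_dim_equal[symmetric])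
  show "subspace {x. R *v x = 0}"
    by (auto simp: subspace_def matrix_vector_right_distrib matrix_vector_mult_scaleR)
  show "subspace (range ((*v) (R - trace2 R *\<^sub>R mat 1)))"
    by (simp add: subspace_UNIV linear_subspace_image)
  have "R ** (R - trace2 R *\<^sub>R mat 1) = 0"
    using assms(2) unfolding trace2_def det_2
    by (simp add: vec_eq_iff forall_2 matrix_matrix_mult_def sum_2 mat_def) algebra
  then show "range ((*v) (R - trace2 R *\<^sub>R mat 1)) \<subseteq> {x. R *v x = 0}"
    by (auto simp: matrix_vector_mul_assoc)
  have "{x. R *v x = 0} \<noteq> UNIV"
    using assms(1) by (metis (mono_tags) UNIV_I mem_Collect_eq matrix_eq matrix_vector_mult_0)
  then have "dim {x. R *v x = 0} \<noteq> DIM(real^2)"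
    using \<open>subspace {x. R *v x = 0}\<close> by (metis dim_eq_full span_eq_iff)
  then have "dim {x. R *v x = 0} \<le> 1"
    using dim_subset_UNIV[of "{x. R *v x = 0}"] by simp
  also have "1 = dim (range ((*v) (R - trace2 R *\<^sub>R mat 1)))"
    using is_line_range_rank1[OF adjugate_rank1[OF assms]] by (simp add: is_line_def)
  finally show "dim (range ((*v) (R - trace2 R *\<^sub>R mat 1))) \<ge> dim {x. R *v x = 0}" .
qed

lemma trace_det_eq_eigenvalues:
  assumes "is_real_eig M a" "is_real_eig M b" "a \<noteq> b"
  shows "trace2 M = a + b" "det M = a * b"
proof -
  have ea: "a\<^sup>2 - trace2 M * a + det M = 0" and eb: "b\<^sup>2 - trace2 M * b + det M = 0"
    using assms is_real_eig_iff by auto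
  then have "(a - b) * (a + b - trace2 M) = 0" by (simp add: power2_eq_square algebra_simps)
  then show tr: "trace2 M = a + b" using assms(3) by simp
  show "det M = a * b" using ea tr by (simp add: power2_eq_square algebra_simps)
qed

text \<open>Cayley--Hamilton in factored form: \<open>(M - p) (M - q) = 0\<close>.\<close>
lemma eigenspace_eq_range:
  fixes M :: mat2
  assumes "trace2 M = p + q" "det M = p * q" "p \<noteq> q"
  shows "{x. M *v x = p *\<^sub>R x} = range ((*v) (M - q *\<^sub>R mat 1))"
proof
  have "(M - p *\<^sub>R mat 1) ** (M - q *\<^sub>R mat 1) = 0"
    using assms(1,2) unfolding trace2_def det_2
    by (simp add: vec_eq_iff forall_2 matrix_matrix_mult_def sum_2 mat_def) algebra
  then have "(M - p *\<^sub>R mat 1) *v ((M - q *\<^sub>R mat 1) *v y) = 0" for y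
    by (simp add: matrix_vector_mul_assoc)
  then show "range ((*v) (M - q *\<^sub>R mat 1)) \<subseteq> {x. M *v x = p *\<^sub>R x}"
    by (auto simp: matrix_minus_scalar_apply)
  show "{x. M *v x = p *\<^sub>R x} \<subseteq> range ((*v) (M - q *\<^sub>R mat 1))"
  proof clarify
    fix x assume x: "M *v x = p *\<^sub>R x"
    have "p / (p - q) = 1 + q / (p - q)" using assms(3) by (simp add: field_simps)
    then have "(M - q *\<^sub>R mat 1) *v ((1 / (p - q)) *\<^sub>R x) = x"
      using assms(3)
      by (simp add: matrix_minus_scalar_apply matrix_vector_mult_scaleR x algebra_simps
          flip: scaleR_matrix_vector_assoc)
    then show "x \<in> range ((*v) (M - q *\<^sub>R mat 1))" by (metis rangeI)
  qed
qed

lemma proximal_eigenspaces: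
  assumes ea: "is_real_eig M a" and eb: "is_real_eig M b" and lt: "\<bar>b\<bar> < \<bar>a\<bar>"
  shows "proximal M"
    and "u_space M = {x. M *v x = a *\<^sub>R x}" "s_space M = {x. M *v x = b *\<^sub>R x}"
    and "u_space M = range ((*v) (M - b *\<^sub>R mat 1))"
    and "s_space M = range ((*v) (M - a *\<^sub>R mat 1))"
proof -
  have ab: "a \<noteq> b" using lt by auto
  note tr_det = trace_det_eq_eigenvalues[OF ea eb ab]
  have eig_cases: "l = a \<or> l = b" if "is_real_eig M l" for l
  proof -
    have "(l - a) * (l - b) = 0"
      using that tr_det by (simp add: is_real_eig_iff power2_eq_square algebra_simps)
    then show ?thesis by simp
  qed
  show "proximal M" using ea eb lt unfolding proximal_def by force
  have "eig_large M = a" unfolding eig_large_def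
  proof (rule the_equality)
    fix l assume "is_real_eig M l \<and> (\<exists>m. is_real_eig M m \<and> \<bar>m\<bar> < \<bar>l\<bar>)"
    then show "l = a" using eig_cases lt by (metis less_asym)
  qed (use ea eb lt in auto)
  then show u: "u_space M = {x. M *v x = a *\<^sub>R x}" by (simp add: u_space_def)
  have "eig_small M = b" unfolding eig_small_def
  proof (rule the_equality)
    fix l assume "is_real_eig M l \<and> (\<exists>m. is_real_eig M m \<and> \<bar>l\<bar> < \<bar>m\<bar>)"
    then show "l = b" using eig_cases lt by (metis less_asym)
  qed (use ea eb lt in auto)
  then show s: "s_space M = {x. M *v x = b *\<^sub>R x}" by (simp add: s_space_def)
  show "u_space M = range ((*v) (M - b *\<^sub>R mat 1))"
    using u eigenspace_eq_range tr_det ab by simp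
  show "s_space M = range ((*v) (M - a *\<^sub>R mat 1))"
    using s eigenspace_eq_range[of M b a] tr_det ab by (simp add: ac_simps)
qed

lemma proximalE:
  assumes "proximal M"
  obtains a b where "is_real_eig M a" "is_real_eig M b" "\<bar>b\<bar> < \<bar>a\<bar>"
  using assms unfolding proximal_def by (metis linorder_neqE_linordered_idom)

lemma is_real_eig_scaleR: "is_real_eig M a \<Longrightarrow> is_real_eig (c *\<^sub>R M) (c * a)"
  by (auto simp: is_real_eig_def simp flip: scaleR_matrix_vector_assoc)

lemma proximal_scaleR:
  assumes "proximal M" "c \<noteq> 0"
  shows "proximal (c *\<^sub>R M)" "u_space (c *\<^sub>R M) = u_space M" "s_space (c *\<^sub>R M) = s_space M"
proof -
  obtain a b where ab: "is_real_eig M a" "is_real_eig M b" "\<bar>b\<bar> < \<bar>a\<bar>"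
    using assms(1) by (rule proximalE)
  have "\<bar>c * b\<bar> < \<bar>c * a\<bar>" using ab(3) assms(2) by (simp add: abs_mult)
  note scaled = proximal_eigenspaces[OF is_real_eig_scaleR[OF ab(1)] is_real_eig_scaleR[OF ab(2)] this]
  note orig = proximal_eigenspaces[OF ab]
  show "proximal (c *\<^sub>R M)" by (rule scaled(1))
  show "u_space (c *\<^sub>R M) = u_space M" "s_space (c *\<^sub>R M) = s_space M"
    unfolding scaled(2,3) orig(2,3) using assms(2)
    by (auto simp del: scaleR_scaleR simp flip: scaleR_matrix_vector_assoc scaleR_scaleR)
qed

lemma semigroup_gen_mult:
  assumes "M \<in> semigroup_gen S" "N \<in> semigroup_gen S"
  shows "M ** N \<in> semigroup_gen S"
  using assms(2)
proof induction
  case (base N)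
  then show ?case by (rule semigroup_gen.step[OF assms(1)])
next
  case (step N K)
  then show ?case by (metis matrix_mul_assoc semigroup_gen.step)
qed

primrec mat_power :: "mat2 \<Rightarrow> nat \<Rightarrow> mat2" where
  "mat_power M 0 = mat 1"
| "mat_power M (Suc n) = mat_power M n ** M"

lemma mat_power_in_semigroup_gen:
  "M \<in> semigroup_gen S \<Longrightarrow> mat_power M (Suc n) \<in> semigroup_gen S"
  by (induction n) (simp_all add: matrix_mul_lid semigroup_gen.base semigroup_gen_mult)

definition scaled_semigroup :: "mat2 set \<Rightarrow> mat2 set" where
  "scaled_semigroup S = {c *\<^sub>R M | c M. M \<in> semigroup_gen S}"

lemma scrS_eq_closure: "scrS S = closure (scaled_semigroup S)"
  by (simp add: scrS_def scaled_semigroup_def)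

lemma mem_scrR_iff: "R \<in> scrR S \<longleftrightarrow> R \<in> scrS S \<and> R \<noteq> 0 \<and> det R = 0"
  unfolding scrR_def rank_mat2_eq_1_iff by simp

lemma scrS_scaleR:
  assumes "R \<in> scrS S"
  shows "c *\<^sub>R R \<in> scrS S"
proof -
  have "(*\<^sub>R) c ` scaled_semigroup S \<subseteq> scaled_semigroup S"
    by (force simp: scaled_semigroup_def)
  then have "(*\<^sub>R) c ` scrS S \<subseteq> scrS S"
    unfolding scrS_eq_closure closure_scaleR by (rule closure_mono)
  then show ?thesis using assms by blast
qed

lemma matrix_add_rdistrib: "(A + B) ** C = A ** C + B ** C"
  for A B :: "'a::semiring_1^'n^'m"
  by (simp add: matrix_matrix_mult_def vec_eq_iff sum.distrib distrib_right)

lemma minus_scalar_mult_self: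
  fixes M :: mat2
  assumes "trace2 M = p + q" "det M = p * q"
  shows "(M - q *\<^sub>R mat 1) ** M = p *\<^sub>R (M - q *\<^sub>R mat 1)"
  using assms unfolding trace2_def det_2
  by (simp add: vec_eq_iff forall_2 matrix_matrix_mult_def sum_2 mat_def) algebra

text \<open>Powers of \<open>M\<close> in its spectral decomposition \<open>M = a P + b Q\<close>, where \<open>P, Q\<close> are the
  projections onto the two eigenlines.\<close>
lemma mat_power_spectral:
  fixes M :: mat2
  assumes "trace2 M = a + b" "det M = a * b" "a \<noteq> b"
  shows "mat_power M n = a ^ n *\<^sub>R ((1 / (a - b)) *\<^sub>R (M - b *\<^sub>R mat 1))
    + b ^ n *\<^sub>R ((1 / (b - a)) *\<^sub>R (M - a *\<^sub>R mat 1))"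
proof (induction n)
  case 0
  have "1 / (b - a) = - (1 / (a - b))" by (simp add: divide_simps)
  then have "(1 / (a - b)) *\<^sub>R (M - b *\<^sub>R mat 1) + (1 / (b - a)) *\<^sub>R (M - a *\<^sub>R mat 1)
      = (1 / (a - b)) *\<^sub>R ((a - b) *\<^sub>R mat 1)"
    by (simp add: algebra_simps flip: scaleR_diff_right)
  then show ?case using assms(3) by simp
next
  case (Suc n)
  have "(M - b *\<^sub>R mat 1) ** M = a *\<^sub>R (M - b *\<^sub>R mat 1)"
    "(M - a *\<^sub>R mat 1) ** M = b *\<^sub>R (M - a *\<^sub>R mat 1)"
    using minus_scalar_mult_self[of M a b] minus_scalar_mult_self[of M b a] assms(1,2)
    by (simp_all add: ac_simps)
  then show ?case
    by (simp add: Suc matrix_add_rdistrib ac_simps flip: scalar_matrix_assoc)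
qed

text \<open>The rank one projection \<open>P\<close> onto \<open>u(M)\<close> along \<open>s(M)\<close> is the limit of the normalised
  powers \<open>M\<^sup>n / a\<^sup>n\<close>.\<close>
lemma proximal_projection_in_scrR:
  assumes M: "M \<in> semigroup_gen S" and ea: "is_real_eig M a" and eb: "is_real_eig M b"
    and lt: "\<bar>b\<bar> < \<bar>a\<bar>"
  defines "P \<equiv> (1 / (a - b)) *\<^sub>R (M - b *\<^sub>R mat 1)"
  shows "P \<in> scrR S" "range ((*v) P) = u_space M" "{x. P *v x = 0} = s_space M"
proof -
  have ab: "a \<noteq> b" and a0: "a \<noteq> 0" using lt by auto
  note tr_det = trace_det_eq_eigenvalues[OF ea eb ab]
  define Q where "Q = (1 / (b - a)) *\<^sub>R (M - a *\<^sub>R mat 1)"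
  have "(1 / a ^ Suc n) *\<^sub>R mat_power M (Suc n) = P + ((b / a) ^ Suc n) *\<^sub>R Q" for n
  proof -
    have "mat_power M (Suc n) = a ^ Suc n *\<^sub>R P + b ^ Suc n *\<^sub>R Q"
      unfolding P_def Q_def by (rule mat_power_spectral[OF tr_det ab])
    then show ?thesis
      using a0 by (simp add: power_divide scaleR_add_right del: power_Suc mat_power.simps)
  qed
  moreover have "(\<lambda>n. P + ((b / a) ^ Suc n) *\<^sub>R Q) \<longlonglongrightarrow> P + 0 *\<^sub>R Q"
    using lt by (intro tendsto_intros LIMSEQ_power_zero[THEN LIMSEQ_Suc]) (simp add: abs_divide)
  moreover have "(1 / a ^ Suc n) *\<^sub>R mat_power M (Suc n) \<in> scaled_semigroup S" for n
    using mat_power_in_semigroup_gen[OF M] unfolding scaled_semigroup_def by blast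
  ultimately have "P \<in> scrS S"
    unfolding scrS_eq_closure closure_sequential
    by (intro exI[of _ "\<lambda>n. (1 / a ^ Suc n) *\<^sub>R mat_power M (Suc n)"]) simp
  moreover obtain v where v: "v \<noteq> 0" "M *v v = a *\<^sub>R v"
    using ea by (auto simp: is_real_eig_def)
  then have "P *v v = v"
    using ab unfolding P_def
    by (simp add: matrix_minus_scalar_apply flip: scaleR_matrix_vector_assoc scaleR_diff_left)
  then have "P \<noteq> 0" using v by auto
  moreover have "det (M - b *\<^sub>R mat 1) = 0"
    using eb by (simp add: det_minus_scalar is_real_eig_iff)
  then have "det P = 0" unfolding P_def by (simp add: det_2)
  ultimately show "P \<in> scrR S" by (simp add: mem_scrR_iff)
  note eigenspaces = proximal_eigenspaces[OF ea eb lt]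
  show "range ((*v) P) = u_space M"
    using ab unfolding P_def eigenspaces(4) by (simp add: range_scaleR_matrix)
  show "{x. P *v x = 0} = s_space M"
    using ab unfolding P_def eigenspaces(3)
    by (auto simp: matrix_minus_scalar_apply simp flip: scaleR_matrix_vector_assoc)
qed

lemma opnorm_scaleR: "opnorm (c *\<^sub>R M) = \<bar>c\<bar> * opnorm M"
  unfolding opnorm_def scaleR_matrix_vector_assoc[symmetric]
  by (rule onorm_scaleR) (rule matrix_vector_mul_bounded_linear)

lemma norm_le_opnorm: "norm (M *v x) \<le> opnorm M * norm x"
  unfolding opnorm_def by (rule onorm) (rule matrix_vector_mul_bounded_linear)

lemma opnorm_le_entries: "opnorm M \<le> (\<Sum>i\<in>UNIV. \<Sum>j\<in>UNIV. \<bar>M $ i $ j\<bar>)"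
  unfolding opnorm_def by (rule onorm_le_matrix_component_sum)

lemma scaled_semigroup_opnorm_square:
  assumes am: "\<forall>A\<in>semigroup_gen S. \<forall>B\<in>semigroup_gen S. \<kappa> * opnorm A * opnorm B \<le> opnorm (A ** B)"
    and N: "N \<in> scaled_semigroup S"
  shows "\<kappa> * (opnorm N)\<^sup>2 \<le> opnorm (N ** N)"
proof -
  obtain c M where N: "N = c *\<^sub>R M" and M: "M \<in> semigroup_gen S"
    using N by (auto simp: scaled_semigroup_def)
  have "\<kappa> * (opnorm N)\<^sup>2 = (c * c) * (\<kappa> * opnorm M * opnorm M)"
    by (simp add: N opnorm_scaleR power2_eq_square abs_mult_self_eq algebra_simps)
  also have "\<dots> \<le> (c * c) * opnorm (M ** M)"
    using am M by (intro mult_left_mono) auto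
  also have "\<dots> = opnorm (N ** N)"
    by (simp add: N opnorm_scaleR abs_mult_self_eq matrix_scalar_ac flip: scalar_matrix_assoc)
  finally show ?thesis .
qed

text \<open>Almost multiplicativity passes to the closure in the weak form
  \<open>\<kappa> |R x|\<^sup>2 \<le> \<Sigma> |(R R)\<^sub>i\<^sub>j|\<close> for unit vectors \<open>x\<close>, which forbids nonzero nilpotents.\<close>
lemma scrS_square_nonzero:
  assumes am: "almost_multiplicative (semigroup_gen S)"
    and R: "R \<in> scrS S" "R \<noteq> 0"
  shows "R ** R \<noteq> 0"
proof
  assume RR: "R ** R = 0"
  obtain \<kappa> where \<kappa>: "\<kappa> > 0"
    and am\<kappa>: "\<forall>A\<in>semigroup_gen S. \<forall>B\<in>semigroup_gen S. \<kappa> * opnorm A * opnorm B \<le> opnorm (A ** B)"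
    using am unfolding almost_multiplicative_def by blast
  obtain f where f: "\<And>n. f n \<in> scaled_semigroup S" "f \<longlonglongrightarrow> R"
    using R(1) unfolding scrS_eq_closure closure_sequential by blast
  obtain j where j: "column j R \<noteq> 0" using R(2) by (rule obtain_column_nonzero)
  define x :: "real^2" where "x = axis j 1"
  have Rx: "R *v x = column j R" by (simp add: x_def matrix_vector_mult_basis)
  have bound: "\<kappa> * (norm (f n *v x))\<^sup>2 \<le> (\<Sum>i\<in>UNIV. \<Sum>j\<in>UNIV. \<bar>(f n ** f n) $ i $ j\<bar>)" for n
  proof -
    have "norm (f n *v x) \<le> opnorm (f n)" using norm_le_opnorm[of "f n" x] by (simp add: x_def)
    then have "\<kappa> * (norm (f n *v x))\<^sup>2 \<le> \<kappa> * (opnorm (f n))\<^sup>2"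
      using \<kappa> by (simp add: power_mono)
    also have "\<dots> \<le> opnorm (f n ** f n)" by (rule scaled_semigroup_opnorm_square[OF am\<kappa> f(1)])
    also have "\<dots> \<le> (\<Sum>i\<in>UNIV. \<Sum>j\<in>UNIV. \<bar>(f n ** f n) $ i $ j\<bar>)" by (rule opnorm_le_entries)
    finally show ?thesis .
  qed
  have "(\<lambda>n. f n *v x) \<longlonglongrightarrow> R *v x"
    unfolding matrix_vector_mult_def using f(2)
    by (intro tendsto_vec_lambda tendsto_sum tendsto_mult tendsto_vec_nth tendsto_const)
  then have "(\<lambda>n. \<kappa> * (norm (f n *v x))\<^sup>2) \<longlonglongrightarrow> \<kappa> * (norm (R *v x))\<^sup>2"
    by (intro tendsto_intros)
  moreover have "(\<lambda>n. f n ** f n) \<longlonglongrightarrow> R ** R"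
    unfolding matrix_matrix_mult_def using f(2)
    by (intro tendsto_vec_lambda tendsto_sum tendsto_mult tendsto_vec_nth)
  then have "(\<lambda>n. \<Sum>i\<in>UNIV. \<Sum>j\<in>UNIV. \<bar>(f n ** f n) $ i $ j\<bar>)
      \<longlonglongrightarrow> (\<Sum>i\<in>UNIV. \<Sum>j\<in>UNIV. \<bar>(R ** R) $ i $ j\<bar>)"
    by (intro tendsto_sum tendsto_rabs tendsto_vec_nth)
  ultimately have "\<kappa> * (norm (R *v x))\<^sup>2 \<le> (\<Sum>i\<in>UNIV. \<Sum>j\<in>UNIV. \<bar>(R ** R) $ i $ j\<bar>)"
    using bound by (intro LIMSEQ_le) auto
  then show False using \<kappa> j Rx RR by (simp add: mult_le_0_iff)
qed

lemma scrR_trace_nonzero: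
  assumes "almost_multiplicative (semigroup_gen S)" "R \<in> scrR S"
  shows "trace2 R \<noteq> 0"
proof -
  have R: "R \<in> scrS S" "R \<noteq> 0" "det R = 0"
    using assms(2) by (simp_all add: mem_scrR_iff)
  then have "R ** R = trace2 R *\<^sub>R R" by (simp add: mat2_square)
  with scrS_square_nonzero[OF assms(1) R(1,2)] show ?thesis by auto
qed

text \<open>The root of \<open>l\<^sup>2 - T l + D\<close> taken with the sign \<open>\<sigma>\<close> of \<open>T\<close> is the one of larger modulus.\<close>
lemma quadratic_roots_separated:
  fixes T D \<sigma> :: real
  assumes \<sigma>: "\<sigma> * \<sigma> = 1" and disc: "T\<^sup>2 - 4 * D > 0" and sign: "\<sigma> * T > 0"
  defines "l \<equiv> (T + \<sigma> * sqrt (T\<^sup>2 - 4 * D)) / 2"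
  shows "l\<^sup>2 - T * l + D = 0" "(T - l)\<^sup>2 - T * (T - l) + D = 0" "\<bar>T - l\<bar> < \<bar>l\<bar>"
proof -
  define q where "q = sqrt (T\<^sup>2 - 4 * D)"
  have q2: "q * q = T\<^sup>2 - 4 * D" and q: "q > 0"
    using disc unfolding q_def by (simp_all flip: real_sqrt_mult)
  have l: "l = (T + \<sigma> * q) / 2" unfolding l_def q_def ..
  have "l\<^sup>2 - T * l + D = ((\<sigma> * \<sigma>) * (q * q) - T\<^sup>2 + 4 * D) / 4"
    "(T - l)\<^sup>2 - T * (T - l) + D = ((\<sigma> * \<sigma>) * (q * q) - T\<^sup>2 + 4 * D) / 4"
    unfolding l by (simp_all add: power2_eq_square field_simps)
  then show "l\<^sup>2 - T * l + D = 0" "(T - l)\<^sup>2 - T * (T - l) + D = 0"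
    using q2 \<sigma> by simp_all
  have "l * l - (T - l) * (T - l) = (\<sigma> * T) * q"
    unfolding l by (simp add: field_simps)
  moreover have "0 < (\<sigma> * T) * q" using sign q by simp
  ultimately have "(T - l) * (T - l) < l * l" by linarith
  then show "\<bar>T - l\<bar> < \<bar>l\<bar>" by (metis abs_mult_self_eq abs_ge_zero mult_mono not_less)
qed

lemma eventually_separated_eigenvalues:
  fixes f :: "nat \<Rightarrow> mat2"
  assumes f: "f \<longlonglongrightarrow> R" and R: "det R = 0" "trace2 R \<noteq> 0"
  obtains l1 l2 where "l1 \<longlonglongrightarrow> trace2 R" "l2 \<longlonglongrightarrow> 0"
    "eventually (\<lambda>n. is_real_eig (f n) (l1 n) \<and> is_real_eig (f n) (l2 n) \<and> \<bar>l2 n\<bar> < \<bar>l1 n\<bar>)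
      sequentially"
proof -
  define t where "t = trace2 R"
  define \<sigma> where "\<sigma> = sgn t"
  have \<sigma>: "\<sigma> * \<sigma> = 1" "\<sigma> * t > 0" "(t + \<sigma> * \<bar>t\<bar>) / 2 = t"
    using R(2) unfolding \<sigma>_def t_def by (auto simp: sgn_if)
  define T where "T n = trace2 (f n)" for n
  define D where "D n = det (f n)" for n
  define l1 where "l1 n = (T n + \<sigma> * sqrt ((T n)\<^sup>2 - 4 * D n)) / 2" for n
  have T: "T \<longlonglongrightarrow> t"
    unfolding T_def t_def trace2_def using f by (intro tendsto_add tendsto_vec_nth)
  have "D \<longlonglongrightarrow> det R"
    unfolding D_def det_2 using f by (intro tendsto_diff tendsto_mult tendsto_vec_nth)
  then have disc: "(\<lambda>n. (T n)\<^sup>2 - 4 * D n) \<longlonglongrightarrow> t\<^sup>2"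
    using T R(1) by (auto intro!: tendsto_eq_intros)
  then have "(\<lambda>n. sqrt ((T n)\<^sup>2 - 4 * D n)) \<longlonglongrightarrow> \<bar>t\<bar>"
    using tendsto_real_sqrt by fastforce
  then have "l1 \<longlonglongrightarrow> (t + \<sigma> * \<bar>t\<bar>) / 2"
    unfolding l1_def by (intro tendsto_divide tendsto_add tendsto_mult tendsto_const T) simp_all
  then have l1: "l1 \<longlonglongrightarrow> t" using \<sigma>(3) by simp
  show thesis
  proof
    show "l1 \<longlonglongrightarrow> trace2 R" using l1 by (simp add: t_def)
    show "(\<lambda>n. T n - l1 n) \<longlonglongrightarrow> 0" using tendsto_diff[OF T l1] by simp
    have "eventually (\<lambda>n. (T n)\<^sup>2 - 4 * D n > 0) sequentially"
      using order_tendstoD(1)[OF disc, of 0] R(2) by (simp add: t_def)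
    moreover have "eventually (\<lambda>n. \<sigma> * T n > 0) sequentially"
      using order_tendstoD(1)[OF tendsto_mult[OF tendsto_const T] \<sigma>(2)] by simp
    ultimately show "eventually (\<lambda>n. is_real_eig (f n) (l1 n) \<and> is_real_eig (f n) (T n - l1 n)
        \<and> \<bar>T n - l1 n\<bar> < \<bar>l1 n\<bar>) sequentially"
    proof eventually_elim
      case (elim n)
      from quadratic_roots_separated[OF \<sigma>(1) elim] show ?case
        unfolding is_real_eig_iff l1_def T_def D_def by simp
    qed
  qed
qed

definition proximal_u_spaces :: "mat2 set \<Rightarrow> (real^2) set set" where
  "proximal_u_spaces S = {u_space M | M. M \<in> semigroup_gen S \<and> proximal M}"

definition proximal_s_spaces :: "mat2 set \<Rightarrow> (real^2) set set" where
  "proximal_s_spaces S = {s_space M | M. M \<in> semigroup_gen S \<and> proximal M}"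

lemma scaled_semigroup_proximal:
  assumes "N \<in> scaled_semigroup S" "N \<noteq> 0" "proximal N"
  shows "u_space N \<in> proximal_u_spaces S" "s_space N \<in> proximal_s_spaces S"
proof -
  obtain c M where N: "N = c *\<^sub>R M" "M \<in> semigroup_gen S"
    using assms(1) by (auto simp: scaled_semigroup_def)
  with assms(2) have c: "c \<noteq> 0" by auto
  then have M: "M = (1 / c) *\<^sub>R N" by (simp add: N)
  have "1 / c \<noteq> 0" using c by simp
  note scaled = proximal_scaleR[OF assms(3) this, folded M]
  then show "u_space N \<in> proximal_u_spaces S" "s_space N \<in> proximal_s_spaces S"
    using N(2) unfolding proximal_u_spaces_def proximal_s_spaces_def by auto
qed

lemma proximal_spaces_in_image_scrR:
  "proximal_u_spaces S \<subseteq> (\<lambda>R. range ((*v) R)) ` scrR S"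
  "proximal_s_spaces S \<subseteq> (\<lambda>R. {x. R *v x = 0}) ` scrR S"
proof -
  have "u_space M \<in> (\<lambda>R. range ((*v) R)) ` scrR S \<and> s_space M \<in> (\<lambda>R. {x. R *v x = 0}) ` scrR S"
    if M: "M \<in> semigroup_gen S" and prox: "proximal M" for M
  proof -
    obtain a b where "is_real_eig M a" "is_real_eig M b" "\<bar>b\<bar> < \<bar>a\<bar>"
      using prox by (rule proximalE)
    note P = proximal_projection_in_scrR[OF M this]
    show ?thesis by (intro conjI rev_image_eqI[OF P(1)]) (simp_all add: P(2,3))
  qed
  then show "proximal_u_spaces S \<subseteq> (\<lambda>R. range ((*v) R)) ` scrR S"
    "proximal_s_spaces S \<subseteq> (\<lambda>R. {x. R *v x = 0}) ` scrR S"
    unfolding proximal_u_spaces_def proximal_s_spaces_def by auto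
qed

lemma line_proj_range_limit_in_closure:
  fixes Q :: "nat \<Rightarrow> mat2"
  assumes "Q \<longlonglongrightarrow> Q0" "Q0 \<noteq> 0" "det Q0 = 0"
    and "eventually (\<lambda>n. det (Q n) = 0 \<and> range ((*v) (Q n)) \<in> X) sequentially"
  shows "line_proj (range ((*v) Q0)) \<in> closure (line_proj ` X)"
proof (rule Lim_in_closed_set[OF closed_closure])
  show "((\<lambda>n. line_proj (range ((*v) (Q n)))) \<longlongrightarrow> line_proj (range ((*v) Q0))) sequentially"
    using assms by (intro tendsto_line_proj_range) (auto elim: eventually_mono)
  show "eventually (\<lambda>n. line_proj (range ((*v) (Q n))) \<in> closure (line_proj ` X)) sequentially"
    using assms(4) by (auto elim!: eventually_mono intro: closure_subset[THEN subsetD])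
qed simp

text \<open>Approximate \<open>R\<close> by scaled products \<open>N\<^sub>n\<close>; their eigenvalues tend to \<open>trace2 R\<close> and \<open>0\<close>,
  so \<open>u(N\<^sub>n) = (N\<^sub>n - l\<^sub>2) \<real>\<^sup>2 \<rightarrow> R \<real>\<^sup>2\<close> and \<open>s(N\<^sub>n) = (N\<^sub>n - l\<^sub>1) \<real>\<^sup>2 \<rightarrow> (R - trace2 R) \<real>\<^sup>2 = ker R\<close>.\<close>
lemma scrR_in_closure_proximal_spaces:
  assumes am: "almost_multiplicative (semigroup_gen S)" and R: "R \<in> scrR S"
  shows "line_proj (range ((*v) R)) \<in> closure (line_proj ` proximal_u_spaces S)"
    "line_proj {x. R *v x = 0} \<in> closure (line_proj ` proximal_s_spaces S)"
proof -
  have R0: "R \<in> scrS S" "R \<noteq> 0" "det R = 0"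
    using R by (simp_all add: mem_scrR_iff)
  obtain f where f: "\<And>n. f n \<in> scaled_semigroup S" "f \<longlonglongrightarrow> R"
    using R0(1) unfolding scrS_eq_closure closure_sequential by blast
  obtain l1 l2 where l: "l1 \<longlonglongrightarrow> trace2 R" "l2 \<longlonglongrightarrow> 0"
    and eig: "eventually (\<lambda>n. is_real_eig (f n) (l1 n) \<and> is_real_eig (f n) (l2 n)
      \<and> \<bar>l2 n\<bar> < \<bar>l1 n\<bar>) sequentially"
    using eventually_separated_eigenvalues[OF f(2) R0(3) scrR_trace_nonzero[OF am R]] by blast
  have shift: "(\<lambda>n. f n - l n *\<^sub>R mat 1) \<longlonglongrightarrow> R - c *\<^sub>R mat 1" if "l \<longlonglongrightarrow> c" for l c
    using f(2) that by (intro tendsto_intros)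
  have "eventually (\<lambda>n. f n \<noteq> 0) sequentially"
    by (rule tendsto_imp_eventually_ne[OF f(2) R0(2)])
  with eig have ev: "eventually (\<lambda>n.
      det (f n - l2 n *\<^sub>R mat 1) = 0 \<and> range ((*v) (f n - l2 n *\<^sub>R mat 1)) \<in> proximal_u_spaces S \<and>
      det (f n - l1 n *\<^sub>R mat 1) = 0 \<and> range ((*v) (f n - l1 n *\<^sub>R mat 1)) \<in> proximal_s_spaces S)
      sequentially"
  proof eventually_elim
    case (elim n)
    then have eigs: "is_real_eig (f n) (l1 n)" "is_real_eig (f n) (l2 n)" "\<bar>l2 n\<bar> < \<bar>l1 n\<bar>"
      by simp_all
    note spaces = proximal_eigenspaces[OF eigs]
    show ?case
      using scaled_semigroup_proximal[OF f(1) \<open>f n \<noteq> 0\<close> spaces(1)] spaces(4,5) eigs(1,2)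
      by (simp add: det_minus_scalar is_real_eig_iff)
  qed
  have "eventually (\<lambda>n. det (f n - l2 n *\<^sub>R mat 1) = 0
      \<and> range ((*v) (f n - l2 n *\<^sub>R mat 1)) \<in> proximal_u_spaces S) sequentially"
    using ev by (rule eventually_mono) simp
  from line_proj_range_limit_in_closure[OF shift[OF l(2)] _ _ this] R0(2,3)
  show "line_proj (range ((*v) R)) \<in> closure (line_proj ` proximal_u_spaces S)" by simp
  have "eventually (\<lambda>n. det (f n - l1 n *\<^sub>R mat 1) = 0
      \<and> range ((*v) (f n - l1 n *\<^sub>R mat 1)) \<in> proximal_s_spaces S) sequentially"
    using ev by (rule eventually_mono) simp
  from line_proj_range_limit_in_closure[OF shift[OF l(1)] adjugate_rank1[OF R0(2,3)] this]
  show "line_proj {x. R *v x = 0} \<in> closure (line_proj ` proximal_s_spaces S)"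
    by (simp add: kernel_rank1_eq_range[OF R0(2,3)])
qed

lemma rp1_closure_eq_image:
  fixes G :: "'a::topological_space \<Rightarrow> (real^2) set"
  assumes K: "compact K" and cont: "continuous_on K (\<lambda>R. line_proj (G R))"
    and line: "\<And>R. R \<in> K \<Longrightarrow> is_line (G R)"
    and X_sub: "X \<subseteq> G ` K"
    and approx: "\<And>R. R \<in> K \<Longrightarrow> line_proj (G R) \<in> closure (line_proj ` X)"
  shows "rp1_closure X = G ` K"
proof
  show "G ` K \<subseteq> rp1_closure X"
    using line approx by (auto simp: rp1_closure_def)
  have "closed ((\<lambda>R. line_proj (G R)) ` K)"
    by (intro compact_imp_closed compact_continuous_image K cont)
  then have closure_sub: "closure (line_proj ` X) \<subseteq> (\<lambda>R. line_proj (G R)) ` K"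
    using X_sub by (intro closure_minimal) auto
  show "rp1_closure X \<subseteq> G ` K"
  proof
    fix L assume "L \<in> rp1_closure X"
    then have L: "is_line L" "line_proj L \<in> closure (line_proj ` X)"
      by (simp_all add: rp1_closure_def)
    with closure_sub obtain R where "R \<in> K" "line_proj L = line_proj (G R)" by blast
    then show "L \<in> G ` K" using line_proj_inj[OF L(1) line] by blast
  qed
qed

definition unit_scrR :: "mat2 set \<Rightarrow> mat2 set" where
  "unit_scrR S = scrS S \<inter> sphere 0 1 \<inter> {R. det R = 0}"

lemma compact_unit_scrR: "compact (unit_scrR S)"
proof -
  have "closed {R :: mat2. det R = 0}"
    unfolding det_2 by (intro closed_Collect_eq continuous_intros)
  then have "compact (sphere 0 1 \<inter> (scrS S \<inter> {R. det R = 0}))"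
    by (intro compact_Int_closed compact_sphere closed_Int) (simp_all add: scrS_def)
  then show ?thesis unfolding unit_scrR_def by (simp add: Int_ac)
qed

lemma unit_scrR_subset: "unit_scrR S \<subseteq> scrR S"
  by (auto simp: unit_scrR_def mem_scrR_iff)

lemma unit_scrR_rank1: "R \<in> unit_scrR S \<Longrightarrow> R \<noteq> 0 \<and> det R = 0"
  using unit_scrR_subset mem_scrR_iff by blast

lemma image_unit_scrR:
  assumes "\<And>R c. c \<noteq> 0 \<Longrightarrow> G (c *\<^sub>R R) = G R"
  shows "G ` unit_scrR S = G ` scrR S"
proof
  show "G ` unit_scrR S \<subseteq> G ` scrR S" using unit_scrR_subset by blast
  show "G ` scrR S \<subseteq> G ` unit_scrR S"
  proof clarify
    fix R assume R: "R \<in> scrR S"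
    then have "R \<in> scrS S" "R \<noteq> 0" "det R = 0" by (simp_all add: mem_scrR_iff)
    moreover have "det ((1 / norm R) *\<^sub>R R) = (1 / norm R)\<^sup>2 * det R"
      unfolding det_2 by (simp add: power2_eq_square algebra_simps)
    ultimately have "(1 / norm R) *\<^sub>R R \<in> unit_scrR S"
      by (simp add: unit_scrR_def scrS_scaleR)
    moreover have "G R = G ((1 / norm R) *\<^sub>R R)" using assms \<open>R \<noteq> 0\<close> by simp
    ultimately show "G R \<in> G ` unit_scrR S" by blast
  qed
qed

lemma continuous_on_line_proj_range:
  assumes "\<And>R. R \<in> K \<Longrightarrow> Q R \<noteq> 0 \<and> det (Q R) = 0" "continuous_on K Q"
  shows "continuous_on K (\<lambda>R. line_proj (range ((*v) (Q R))))"
  unfolding continuous_on_def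
proof
  fix R assume R: "R \<in> K"
  have "eventually (\<lambda>x. det (Q x) = 0) (at R within K)"
    using assms(1) by (auto simp: eventually_at_filter)
  moreover have "(Q \<longlongrightarrow> Q R) (at R within K)"
    using assms(2) R by (simp add: continuous_on_def)
  ultimately show "((\<lambda>R. line_proj (range ((*v) (Q R)))) \<longlongrightarrow> line_proj (range ((*v) (Q R))))
      (at R within K)"
    using assms(1)[OF R] by (intro tendsto_line_proj_range) auto
qed

lemma rp1_closure_proximal_u_spaces:
  assumes "almost_multiplicative (semigroup_gen S)"
  shows "rp1_closure (proximal_u_spaces S) = (\<lambda>R. range ((*v) R)) ` scrR S"
proof -
  have image: "(\<lambda>R. range ((*v) R)) ` unit_scrR S = (\<lambda>R. range ((*v) R)) ` scrR S"
    by (rule image_unit_scrR) (rule range_scaleR_matrix)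
  show ?thesis
    unfolding image[symmetric]
  proof (rule rp1_closure_eq_image[OF compact_unit_scrR])
    show "continuous_on (unit_scrR S) (\<lambda>R. line_proj (range ((*v) R)))"
      using unit_scrR_rank1 by (intro continuous_on_line_proj_range continuous_on_id) auto
    show "is_line (range ((*v) R))" if "R \<in> unit_scrR S" for R
      using unit_scrR_rank1[OF that] by (simp add: is_line_range_rank1)
    show "proximal_u_spaces S \<subseteq> (\<lambda>R. range ((*v) R)) ` unit_scrR S"
      unfolding image by (rule proximal_spaces_in_image_scrR(1))
    show "line_proj (range ((*v) R)) \<in> closure (line_proj ` proximal_u_spaces S)"
      if "R \<in> unit_scrR S" for R
      using scrR_in_closure_proximal_spaces(1)[OF assms] unit_scrR_subset that by blast
  qed
qed

lemma rp1_closure_proximal_s_spaces: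
  assumes "almost_multiplicative (semigroup_gen S)"
  shows "rp1_closure (proximal_s_spaces S) = (\<lambda>R. {x. R *v x = 0}) ` scrR S"
proof -
  have "{x. (c *\<^sub>R R) *v x = 0} = {x. R *v x = 0}" if "c \<noteq> 0" for c and R :: mat2
    using that by (simp flip: scaleR_matrix_vector_assoc)
  then have image: "(\<lambda>R. {x. R *v x = 0}) ` unit_scrR S = (\<lambda>R. {x. R *v x = 0}) ` scrR S"
    by (rule image_unit_scrR)
  have kernel: "{x. R *v x = 0} = range ((*v) (R - trace2 R *\<^sub>R mat 1))" if "R \<in> unit_scrR S" for R
    using unit_scrR_rank1[OF that] kernel_rank1_eq_range by blast
  show ?thesis
    unfolding image[symmetric]
  proof (rule rp1_closure_eq_image[OF compact_unit_scrR])
    have "continuous_on (unit_scrR S) (\<lambda>R. R - trace2 R *\<^sub>R mat 1)"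
      unfolding trace2_def by (intro continuous_intros)
    then have "continuous_on (unit_scrR S) (\<lambda>R. line_proj (range ((*v) (R - trace2 R *\<^sub>R mat 1))))"
      using unit_scrR_rank1 adjugate_rank1 by (intro continuous_on_line_proj_range) auto
    moreover have "continuous_on (unit_scrR S) (\<lambda>R. line_proj {x. R *v x = 0})
        = continuous_on (unit_scrR S) (\<lambda>R. line_proj (range ((*v) (R - trace2 R *\<^sub>R mat 1))))"
      by (rule continuous_on_cong) (simp_all add: kernel)
    ultimately show "continuous_on (unit_scrR S) (\<lambda>R. line_proj {x. R *v x = 0})" by simp
    show "is_line {x. R *v x = 0}" if "R \<in> unit_scrR S" for R
      using unit_scrR_rank1[OF that] adjugate_rank1 by (simp add: kernel[OF that] is_line_range_rank1)
    show "proximal_s_spaces S \<subseteq> (\<lambda>R. {x. R *v x = 0}) ` unit_scrR S"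
      unfolding image by (rule proximal_spaces_in_image_scrR(2))
    show "line_proj {x. R *v x = 0} \<in> closure (line_proj ` proximal_s_spaces S)"
      if "R \<in> unit_scrR S" for R
      using scrR_in_closure_proximal_spaces(2)[OF assms] unit_scrR_subset that by blast
  qed
qed

theorem lemma3p4:
  fixes A :: "mat2 set"
  assumes "\<forall>M\<in>A. invertible M"
    and "scrR A \<noteq> {}"
    and "almost_multiplicative (semigroup_gen A)"
  shows "{range (\<lambda>x. M *v x) | M. M \<in> scrR A}
           = rp1_closure {u_space M | M. M \<in> semigroup_gen A \<and> proximal M}
       \<and> {{x. M *v x = 0} | M. M \<in> scrR A}
           = rp1_closure {s_space M | M. M \<in> semigroup_gen A \<and> proximal M}"
proof -
  have "{range (\<lambda>x. M *v x) | M. M \<in> scrR A} = (\<lambda>R. range ((*v) R)) ` scrR A"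
    "{{x. M *v x = 0} | M. M \<in> scrR A} = (\<lambda>R. {x. R *v x = 0}) ` scrR A"
    by (simp_all only: Setcompr_eq_image)
  then show ?thesis
    using rp1_closure_proximal_u_spaces[OF assms(3)] rp1_closure_proximal_s_spaces[OF assms(3)]
    unfolding proximal_u_spaces_def proximal_s_spaces_def by (simp only:)
qed

end
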